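(* Suppose $f(x,\theta)$ is submodular in $(x,\theta)$ and concave in $x$, and the nonnegative random variable $Z(\theta)$ is stochastically increasing in $\theta$ in the usual stochastic order. Then $\mathbb{E}[f(x+Z(\theta),\theta)]$ is submodular in $(x,\theta)$ and concave in $x$.
   Context: Here $x\in\mathbb{R}$, $\theta$ ranges over a subset $\Theta\subseteq\mathbb{R}$, $f:\mathbb{R}\times\Theta\to\mathbb{R}$, and for each $\theta\in\Theta$, $Z(\theta)$ is a nonnegative real random variable. All the expectations $\mathbb{E}[f(x+Z(\theta'),\theta)]$, $x\in\mathbb{R}$, $\theta,\theta'\in\Theta$, are assumed to exist and be finite. "Stochastically increasing in the usual stochastic order" means: for $\theta_1\le\theta_2$, $\mathbb{P}[Z(\theta_1)>z]\le\mathbb{P}[Z(\theta_2)>z]$ for all $z\in\mathbb{R}$. A bivariate function $h(x,y)$ is submodular in $(x,y)$ if for all $x^+\ge x^-$ and $y^+\ge y^-$, $$h(x^+,y^-)-h(x^-,y^-)\ \ge\ h(x^+,y^+)-h(x^-,y^+).$$ *)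

theory Defs
  imports "HOL-Probability.Probability"
begin

definition submodular_on :: "real set \<Rightarrow> real set \<Rightarrow> (real \<Rightarrow> real \<Rightarrow> real) \<Rightarrow> bool" where
  "submodular_on X Y h \<longleftrightarrow>
     (\<forall>x\<^sub>1\<in>X. \<forall>x\<^sub>2\<in>X. \<forall>y\<^sub>1\<in>Y. \<forall>y\<^sub>2\<in>Y. x\<^sub>1 \<le> x\<^sub>2 \<longrightarrow> y\<^sub>1 \<le> y\<^sub>2 \<longrightarrow>
        h x\<^sub>2 y\<^sub>1 - h x\<^sub>1 y\<^sub>1 \<ge> h x\<^sub>2 y\<^sub>2 - h x\<^sub>1 y\<^sub>2)"

definition stochastically_increasing_on ::
    "'a measure \<Rightarrow> real set \<Rightarrow> (real \<Rightarrow> 'a \<Rightarrow> real) \<Rightarrow> bool" where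
  "stochastically_increasing_on M \<Theta> Z \<longleftrightarrow>
     (\<forall>\<theta>\<^sub>1\<in>\<Theta>. \<forall>\<theta>\<^sub>2\<in>\<Theta>. \<theta>\<^sub>1 \<le> \<theta>\<^sub>2 \<longrightarrow>
        (\<forall>z. \<P>(\<omega> in M. Z \<theta>\<^sub>1 \<omega> > z) \<le> \<P>(\<omega> in M. Z \<theta>\<^sub>2 \<omega> > z)))"

end

theory Submission
  imports Defs
begin

text \<open>
  Submodularity of \<open>f\<close> bounds the increment \<open>f (x\<^sub>2 + z) \<theta> - f (x\<^sub>1 + z) \<theta>\<close> at the larger \<open>\<theta>\<close> by the
  one at the smaller \<open>\<theta>\<close>, with \<open>z = Z \<theta>\<close> kept at the larger \<open>\<theta>\<close>. By concavity this increment is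
  decreasing in \<open>z\<close>, so replacing \<open>Z\<close> by its value at the smaller \<open>\<theta>\<close>, which is stochastically
  smaller, only increases its expectation.
\<close>

text \<open>A nonempty proper upper set of reals is bounded below by any point outside it and is
  then determined by its infimum, up to whether the infimum is attained.\<close>

lemma upper_set_real_cases:
  fixes U :: "real set"
  assumes up: "\<And>x y. x \<in> U \<Longrightarrow> x \<le> y \<Longrightarrow> y \<in> U"
  obtains "U = {}" | "U = UNIV" | a where "U = {a<..}" | a where "U = {a..}"
proof (cases "U = {} \<or> U = UNIV")
  case False
  then obtain b where b: "b \<notin> U" and ne: "U \<noteq> {}" by auto
  have bdd: "bdd_below U"
    using b up nle_le by (intro bdd_belowI[of _ b]) blast
  have above: "y \<in> U" if "Inf U < y" for y
    using that cInf_less_iff[OF ne bdd] up less_imp_le by blast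
  have below: "Inf U \<le> y" if "y \<in> U" for y
    using cInf_lower[OF that bdd] .
  show thesis
  proof (cases "Inf U \<in> U")
    case True
    then have "U = {Inf U..}" using below up by auto
    then show thesis using that by blast
  next
    case False
    then have "U = {Inf U<..}" using below above by (force simp: less_le)
    then show thesis using that by blast
  qed
qed (use that in blast)

context prob_space
begin

text \<open>The hypothesis is the case of open rays. A closed ray is the decreasing intersection of
  the open rays from \<open>a - 1 / Suc n\<close>, so continuity from above carries the inequality
  over. Superlevel sets of a monotone function can be rays of either kind.\<close>

lemma stochastic_order_upper_set:
  fixes X Y :: "'a \<Rightarrow> real"
  assumes [measurable]: "random_variable borel X" "random_variable borel Y"
    and le: "\<And>z. prob {\<omega> \<in> space M. z < X \<omega>} \<le> prob {\<omega> \<in> space M. z < Y \<omega>}"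
    and up: "\<And>x y. x \<in> U \<Longrightarrow> x \<le> y \<Longrightarrow> y \<in> U"
  shows "prob {\<omega> \<in> space M. X \<omega> \<in> U} \<le> prob {\<omega> \<in> space M. Y \<omega> \<in> U}"
proof (rule upper_set_real_cases[OF up])
  fix a assume U: "U = {a..}"
  have lim: "(\<lambda>n. prob {\<omega> \<in> space M. a - 1 / Suc n < V \<omega>}) \<longlonglongrightarrow> prob {\<omega> \<in> space M. V \<omega> \<in> U}"
    if [measurable]: "random_variable borel V" for V :: "'a \<Rightarrow> real"
  proof -
    let ?A = "\<lambda>n. {\<omega> \<in> space M. a - 1 / Suc n < V \<omega>}"
    have "a \<le> v" if "\<And>n. a - 1 / Suc n < v" for v :: real
    proof (rule field_le_epsilon)
      fix e :: real assume "0 < e"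
      then obtain n where "inverse (of_nat (Suc n)) < e"
        using reals_Archimedean by blast
      then show "a \<le> v + e" using that[of n] by (simp add: inverse_eq_divide)
    qed
    moreover have "a - 1 / Suc n < v" if "a \<le> v" for n and v :: real
      using that by (smt (verit) divide_pos_pos of_nat_0_less_iff zero_less_Suc)
    ultimately have eq: "(\<Inter>n. ?A n) = {\<omega> \<in> space M. V \<omega> \<in> U}"
      unfolding U by auto
    have "decseq ?A"
    proof (unfold decseq_Suc_iff, intro allI subsetI)
      fix n \<omega> assume "\<omega> \<in> ?A (Suc n)"
      moreover have "1 / Suc (Suc n) \<le> 1 / Suc n" by (intro frac_le) auto
      ultimately show "\<omega> \<in> ?A n" by auto
    qed
    then have "(\<lambda>n. prob (?A n)) \<longlonglongrightarrow> prob (\<Inter>n. ?A n)"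
      by (intro finite_Lim_measure_decseq) auto
    then show ?thesis unfolding eq .
  qed
  show ?thesis
    using le by (intro LIMSEQ_le[OF lim lim]) auto
qed (use le in auto)

text \<open>Tonelli's theorem for the region \<open>0 \<le> t < h \<omega>\<close>. No sign
  condition on \<open>h\<close> is imposed, so that the formula serves for both \<open>g\<close> and
  \<open>- g\<close> below.\<close>

lemma nn_integral_layer_cake:
  fixes h :: "'a \<Rightarrow> real"
  assumes [measurable]: "random_variable borel h"
  shows "(\<integral>\<^sup>+\<omega>. ennreal (h \<omega>) \<partial>M)
    = (\<integral>\<^sup>+t. ennreal (prob {\<omega> \<in> space M. t < h \<omega>}) * indicator {0..} t \<partial>lborel)"
proof -
  interpret pair_sigma_finite M lborel ..
  \<comment> \<open>Where \<open>h\<close> is negative, \<open>ennreal\<close> truncates to 0 and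
    the interval is empty.\<close>
  have slice: "ennreal (h \<omega>) = (\<integral>\<^sup>+t. indicator {0..<h \<omega>} t \<partial>lborel)" for \<omega>
    by (cases "0 \<le> h \<omega>") (auto simp: ennreal_neg)
  have "(\<integral>\<^sup>+\<omega>. ennreal (h \<omega>) \<partial>M)
      = (\<integral>\<^sup>+\<omega>. \<integral>\<^sup>+t. indicator {\<omega> \<in> space M. t < h \<omega>} \<omega> * indicator {0..} t \<partial>lborel \<partial>M)"
    unfolding slice
    by (intro nn_integral_cong) (auto simp: indicator_def)
  also have "\<dots> = (\<integral>\<^sup>+t. \<integral>\<^sup>+\<omega>. indicator {\<omega> \<in> space M. t < h \<omega>} \<omega> * indicator {0..} t \<partial>M \<partial>lborel)"
    by (rule Fubini'[symmetric]) measurable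
  also have "\<dots> = (\<integral>\<^sup>+t. emeasure M {\<omega> \<in> space M. t < h \<omega>} * indicator {0..} t \<partial>lborel)"
    by (intro nn_integral_cong) (simp add: nn_integral_multc)
  finally show ?thesis by (simp add: emeasure_eq_measure)
qed

text \<open>As \<open>g\<close> may change sign, its positive and negative parts are compared
  separately. The layer cake formula turns each into an integral of probabilities that the order
  controls, because \<open>{z. t < g z}\<close> and \<open>{z. - t \<le> g z}\<close> are upper
  sets.\<close>

lemma expectation_mono_stochastic_order:
  fixes X Y :: "'a \<Rightarrow> real" and g :: "real \<Rightarrow> real"
  assumes rv[measurable]: "random_variable borel X" "random_variable borel Y"
    and le: "\<And>z. prob {\<omega> \<in> space M. z < X \<omega>} \<le> prob {\<omega> \<in> space M. z < Y \<omega>}"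
    and g: "mono g"
    and int: "integrable M (\<lambda>\<omega>. g (X \<omega>))" "integrable M (\<lambda>\<omega>. g (Y \<omega>))"
  shows "expectation (\<lambda>\<omega>. g (X \<omega>)) \<le> expectation (\<lambda>\<omega>. g (Y \<omega>))"
proof -
  have [measurable]: "g \<in> borel_measurable borel"
    using g by (rule borel_measurable_mono)
  have "prob {\<omega> \<in> space M. t < g (X \<omega>)} \<le> prob {\<omega> \<in> space M. t < g (Y \<omega>)}" for t
    using stochastic_order_upper_set[OF rv le, of "{z. t < g z}"] monoD[OF g]
    by (auto intro: less_le_trans)
  then have pos: "(\<integral>\<^sup>+\<omega>. ennreal (g (X \<omega>)) \<partial>M) \<le> (\<integral>\<^sup>+\<omega>. ennreal (g (Y \<omega>)) \<partial>M)"
    by (simp add: nn_integral_layer_cake)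
      (intro nn_integral_mono mult_right_mono ennreal_leI, auto)
  \<comment> \<open>Superlevel sets of \<open>- g\<close> are lower sets; passing to the complement
    gives an upper set and reverses the inequality.\<close>
  have compl: "prob {\<omega> \<in> space M. t < - g (V \<omega>)} = 1 - prob {\<omega> \<in> space M. V \<omega> \<in> {z. - t \<le> g z}}"
    if [measurable]: "random_variable borel V" for V t
    by (subst prob_compl[symmetric]) (auto intro!: arg_cong[where f = prob])
  have "prob {\<omega> \<in> space M. t < - g (Y \<omega>)} \<le> prob {\<omega> \<in> space M. t < - g (X \<omega>)}" for t
    using stochastic_order_upper_set[OF rv le, of "{z. - t \<le> g z}"] monoD[OF g]
    unfolding compl[OF rv(1)] compl[OF rv(2)] by (auto intro: order_trans)
  then have neg: "(\<integral>\<^sup>+\<omega>. ennreal (- g (Y \<omega>)) \<partial>M) \<le> (\<integral>\<^sup>+\<omega>. ennreal (- g (X \<omega>)) \<partial>M)"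
    by (simp add: nn_integral_layer_cake)
      (intro nn_integral_mono mult_right_mono ennreal_leI, auto)
  show ?thesis
    \<comment> \<open>Integrability makes all four integrals finite, which the monotonicity of
      \<open>enn2real\<close> requires.\<close>
    using int unfolding real_lebesgue_integral_def[OF int(1)] real_lebesgue_integral_def[OF int(2)]
    by (intro diff_mono enn2real_mono pos neg) (auto simp: real_integrable_def less_top)
qed

end

text \<open>The points \<open>x\<^sub>2 + z\<^sub>1\<close> and \<open>x\<^sub>1 + z\<^sub>2\<close>
  lie between \<open>x\<^sub>1 + z\<^sub>1\<close> and \<open>x\<^sub>2 + z\<^sub>2\<close> and are
  convex combinations of them with swapped weights. Adding the two concavity inequalities cancels
  the weights.\<close>

lemma concave_on_decreasing_increments:
  fixes f :: "real \<Rightarrow> real"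
  assumes f: "concave_on UNIV f" and "x\<^sub>1 \<le> x\<^sub>2" "z\<^sub>1 \<le> z\<^sub>2"
  shows "f (x\<^sub>2 + z\<^sub>2) - f (x\<^sub>1 + z\<^sub>2) \<le> f (x\<^sub>2 + z\<^sub>1) - f (x\<^sub>1 + z\<^sub>1)"
proof (cases "x\<^sub>1 = x\<^sub>2 \<and> z\<^sub>1 = z\<^sub>2")
  case False
  \<comment> \<open>\<open>d\<close> is the distance between the two outer points and
    \<open>t\<close> the relative position of \<open>x\<^sub>2 + z\<^sub>1\<close> between
    them.\<close>
  define d where "d = (x\<^sub>2 - x\<^sub>1) + (z\<^sub>2 - z\<^sub>1)"
  define t where "t = (x\<^sub>2 - x\<^sub>1) / d"
  have d: "d > 0" using assms False by (auto simp: d_def)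
  have t: "0 \<le> t" "t \<le> 1" using d assms by (auto simp: t_def d_def field_simps)
  have td: "t * d = x\<^sub>2 - x\<^sub>1" using d by (simp add: t_def)
  let ?a = "x\<^sub>1 + z\<^sub>1" and ?b = "x\<^sub>2 + z\<^sub>2"
  have b: "?b = ?a + d" by (simp add: d_def)
  have "(1 - t) * ?a + t * ?b = x\<^sub>2 + z\<^sub>1" "t * ?a + (1 - t) * ?b = x\<^sub>1 + z\<^sub>2"
    unfolding b using td by (simp_all add: algebra_simps d_def)
  then have "(1 - t) * f ?a + t * f ?b \<le> f (x\<^sub>2 + z\<^sub>1)" "t * f ?a + (1 - t) * f ?b \<le> f (x\<^sub>1 + z\<^sub>2)"
    using concave_onD[OF f, of t ?a ?b] concave_onD[OF f, of "1 - t" ?a ?b] t by simp_all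
  then show ?thesis by (simp add: algebra_simps)
qed auto

theorem lemma4:
  fixes M :: "'a measure"
    and \<Theta> :: "real set"
    and f :: "real \<Rightarrow> real \<Rightarrow> real"
    and Z :: "real \<Rightarrow> 'a \<Rightarrow> real"
  assumes "prob_space M"
    and "\<And>\<theta>. \<theta> \<in> \<Theta> \<Longrightarrow> Z \<theta> \<in> borel_measurable M"
    and "\<And>\<theta>. \<theta> \<in> \<Theta> \<Longrightarrow> AE \<omega> in M. 0 \<le> Z \<theta> \<omega>"
    and "\<And>x \<theta> \<theta>'. \<theta> \<in> \<Theta> \<Longrightarrow> \<theta>' \<in> \<Theta> \<Longrightarrow> integrable M (\<lambda>\<omega>. f (x + Z \<theta>' \<omega>) \<theta>)"
    and "submodular_on UNIV \<Theta> f"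
    and "\<And>\<theta>. \<theta> \<in> \<Theta> \<Longrightarrow> concave_on UNIV (\<lambda>x. f x \<theta>)"
    and "stochastically_increasing_on M \<Theta> Z"
  shows "submodular_on UNIV \<Theta> (\<lambda>x \<theta>. \<integral>\<omega>. f (x + Z \<theta> \<omega>) \<theta> \<partial>M)
    \<and> (\<forall>\<theta>\<in>\<Theta>. concave_on UNIV (\<lambda>x. \<integral>\<omega>. f (x + Z \<theta> \<omega>) \<theta> \<partial>M))"
proof (intro conjI ballI)
  interpret prob_space M by fact
  note rv = assms(2) and int = assms(4) and conc = assms(6)
  show "submodular_on UNIV \<Theta> (\<lambda>x \<theta>. \<integral>\<omega>. f (x + Z \<theta> \<omega>) \<theta> \<partial>M)"
    unfolding submodular_on_def
  proof (intro ballI impI)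
    fix x\<^sub>1 x\<^sub>2 \<theta>\<^sub>1 \<theta>\<^sub>2 :: real
    assume \<theta>: "\<theta>\<^sub>1 \<in> \<Theta>" "\<theta>\<^sub>2 \<in> \<Theta>" and le: "x\<^sub>1 \<le> x\<^sub>2" "\<theta>\<^sub>1 \<le> \<theta>\<^sub>2"
    \<comment> \<open>The increment with its sign reversed, so that decreasing increments make
      \<open>g\<close> increasing.\<close>
    define g where "g z = f (x\<^sub>1 + z) \<theta>\<^sub>1 - f (x\<^sub>2 + z) \<theta>\<^sub>1" for z
    have g: "mono g"
      using concave_on_decreasing_increments[OF conc[OF \<theta>(1)] le(1)]
      by (auto simp: mono_def g_def algebra_simps)
    \<comment> \<open>For \<open>\<theta>\<^sub>2\<close> this pairs \<open>f\<close> at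
      \<open>\<theta>\<^sub>1\<close> with \<open>Z \<theta>\<^sub>2\<close>; such mixed
      expectations are why integrability is assumed for independent \<open>\<theta>\<close> and
      \<open>\<theta>'\<close>.\<close>
    have int_g: "integrable M (\<lambda>\<omega>. g (Z \<theta> \<omega>))" if "\<theta> \<in> \<Theta>" for \<theta>
      unfolding g_def using int \<theta> that by auto
    have "(\<integral>\<omega>. f (x\<^sub>2 + Z \<theta>\<^sub>2 \<omega>) \<theta>\<^sub>2 \<partial>M) - (\<integral>\<omega>. f (x\<^sub>1 + Z \<theta>\<^sub>2 \<omega>) \<theta>\<^sub>2 \<partial>M)
        = (\<integral>\<omega>. f (x\<^sub>2 + Z \<theta>\<^sub>2 \<omega>) \<theta>\<^sub>2 - f (x\<^sub>1 + Z \<theta>\<^sub>2 \<omega>) \<theta>\<^sub>2 \<partial>M)"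
      using int \<theta> by simp
    also have "\<dots> \<le> (\<integral>\<omega>. - g (Z \<theta>\<^sub>2 \<omega>) \<partial>M)"
      using assms(5) \<theta> le int int_g
      by (intro integral_mono) (auto simp: submodular_on_def g_def)
    also have "\<dots> \<le> (\<integral>\<omega>. - g (Z \<theta>\<^sub>1 \<omega>) \<partial>M)"
      using expectation_mono_stochastic_order[OF rv[OF \<theta>(1)] rv[OF \<theta>(2)] _ g int_g int_g]
        assms(7) \<theta> le
      by (simp add: stochastically_increasing_on_def)
    also have "\<dots> = (\<integral>\<omega>. f (x\<^sub>2 + Z \<theta>\<^sub>1 \<omega>) \<theta>\<^sub>1 \<partial>M) - (\<integral>\<omega>. f (x\<^sub>1 + Z \<theta>\<^sub>1 \<omega>) \<theta>\<^sub>1 \<partial>M)"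
      unfolding g_def using int \<theta> by simp
    finally show "(\<integral>\<omega>. f (x\<^sub>2 + Z \<theta>\<^sub>2 \<omega>) \<theta>\<^sub>2 \<partial>M) - (\<integral>\<omega>. f (x\<^sub>1 + Z \<theta>\<^sub>2 \<omega>) \<theta>\<^sub>2 \<partial>M)
      \<le> (\<integral>\<omega>. f (x\<^sub>2 + Z \<theta>\<^sub>1 \<omega>) \<theta>\<^sub>1 \<partial>M) - (\<integral>\<omega>. f (x\<^sub>1 + Z \<theta>\<^sub>1 \<omega>) \<theta>\<^sub>1 \<partial>M)" .
  qed
next
  fix \<theta> assume \<theta>: "\<theta> \<in> \<Theta>"
  note int = assms(4)[OF \<theta> \<theta>]
  show "concave_on UNIV (\<lambda>x. \<integral>\<omega>. f (x + Z \<theta> \<omega>) \<theta> \<partial>M)"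
    unfolding concave_on_iff
  proof (intro conjI ballI allI impI)
    fix x y u v :: real
    assume uv: "0 \<le> u" "0 \<le> v" "u + v = 1"
    \<comment> \<open>Since the weights sum to 1, a common shift \<open>z\<close> preserves
      concavity; the inequality is then integrated with
      \<open>z = Z \<theta> \<omega>\<close>.\<close>
    have "u * f (x + z) \<theta> + v * f (y + z) \<theta> \<le> f (u *\<^sub>R x + v *\<^sub>R y + z) \<theta>" for z
    proof -
      have "u * (x + z) + v * (y + z) = u * x + v * y + (u + v) * z"
        by (simp add: algebra_simps)
      then show ?thesis
        using assms(6)[OF \<theta>] uv unfolding concave_on_iff
        by (metis UNIV_I mult_1 real_scaleR_def)
    qed
    then have "(\<integral>\<omega>. u * f (x + Z \<theta> \<omega>) \<theta> + v * f (y + Z \<theta> \<omega>) \<theta> \<partial>M)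
        \<le> (\<integral>\<omega>. f (u *\<^sub>R x + v *\<^sub>R y + Z \<theta> \<omega>) \<theta> \<partial>M)"
      by (intro integral_mono Bochner_Integration.integrable_add integrable_mult_right int)
    then show "u * (\<integral>\<omega>. f (x + Z \<theta> \<omega>) \<theta> \<partial>M) + v * (\<integral>\<omega>. f (y + Z \<theta> \<omega>) \<theta> \<partial>M)
        \<le> (\<integral>\<omega>. f (u *\<^sub>R x + v *\<^sub>R y + Z \<theta> \<omega>) \<theta> \<partial>M)"
      using int by simp
  qed auto
qed

end
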